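(* For every $\pi\in\mathfrak S_n$, $$\operatorname{DD}(\Phi(\pi))=\operatorname{DD}(\pi).$$ More precisely, $$\mathcal D(\Phi(\pi))=\{\,n+1-k:k\in\mathcal D(\pi)\,\}.$$
   Context: $\mathfrak S_n$ is the set of permutations of $[n]=\{1,\dots,n\}$. For $\pi\in\mathfrak S_n$, $\mathcal D(\pi)=\{k\in[n]:\pi(k)<k<\pi^{-1}(k)\}$ is the set of double-deficiency indices and $\operatorname{DD}(\pi)=|\mathcal D(\pi)|$. The reverse, complement and inverse are $R(\pi)(i)=\pi(n+1-i)$, $C(\pi)(i)=n+1-\pi(i)$, $I(\pi)=\pi^{-1}$, and $\Phi=C\circ R\circ I$, so explicitly $\Phi(\pi)(i)=n+1-\pi^{-1}(n+1-i)$. *)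

theory Defs
  imports "HOL-Combinatorics.Permutations"
begin

text \<open>
  A permutation of \<open>[n]\<close> is a function \<open>\<pi>\<close> on \<open>nat\<close> with \<open>\<pi> permutes {1..n}\<close>, so it is the
  identity outside \<open>{1..n}\<close>. The operations below are therefore also extended by the
  identity, which makes \<open>inv\<close> of their results the inverse permutation of \<open>[n]\<close>.
\<close>

definition perm_reverse :: "nat \<Rightarrow> (nat \<Rightarrow> nat) \<Rightarrow> (nat \<Rightarrow> nat)" where
  "perm_reverse n \<pi> = (\<lambda>i. if i \<in> {1..n} then \<pi> (n + 1 - i) else i)"

definition perm_complement :: "nat \<Rightarrow> (nat \<Rightarrow> nat) \<Rightarrow> (nat \<Rightarrow> nat)" where
  "perm_complement n \<pi> = (\<lambda>i. if i \<in> {1..n} then n + 1 - \<pi> i else i)"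

definition perm_inverse :: "(nat \<Rightarrow> nat) \<Rightarrow> (nat \<Rightarrow> nat)" where
  "perm_inverse \<pi> = inv \<pi>"

definition perm_Phi :: "nat \<Rightarrow> (nat \<Rightarrow> nat) \<Rightarrow> (nat \<Rightarrow> nat)" where
  "perm_Phi n = perm_complement n \<circ> perm_reverse n \<circ> perm_inverse"

definition double_deficiencies :: "nat \<Rightarrow> (nat \<Rightarrow> nat) \<Rightarrow> nat set" where
  "double_deficiencies n \<pi> = {k \<in> {1..n}. \<pi> k < k \<and> k < inv \<pi> k}"

definition DD :: "nat \<Rightarrow> (nat \<Rightarrow> nat) \<Rightarrow> nat" where
  "DD n \<pi> = card (double_deficiencies n \<pi>)"

lemma perm_reverse_permutes:
  assumes "\<pi> permutes {1..n}"
  shows "perm_reverse n \<pi> permutes {1..n}"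
proof (rule bij_imp_permutes)
  have "bij_betw (\<lambda>i. n + 1 - i) {1..n} {1..n}"
    by (rule bij_betw_byWitness[where f' = "\<lambda>i. n + 1 - i"]) auto
  then have "bij_betw (\<pi> \<circ> (\<lambda>i. n + 1 - i)) {1..n} {1..n}"
    using permutes_imp_bij[OF assms] by (rule bij_betw_trans)
  then show "bij_betw (perm_reverse n \<pi>) {1..n} {1..n}"
    by (rule bij_betw_cong[THEN iffD1, rotated]) (simp add: perm_reverse_def)
qed (auto simp: perm_reverse_def)

lemma perm_complement_permutes:
  assumes "\<pi> permutes {1..n}"
  shows "perm_complement n \<pi> permutes {1..n}"
proof (rule bij_imp_permutes)
  have "bij_betw (\<lambda>i. n + 1 - i) {1..n} {1..n}"
    by (rule bij_betw_byWitness[where f' = "\<lambda>i. n + 1 - i"]) auto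
  with permutes_imp_bij[OF assms] have "bij_betw ((\<lambda>i. n + 1 - i) \<circ> \<pi>) {1..n} {1..n}"
    by (rule bij_betw_trans)
  then show "bij_betw (perm_complement n \<pi>) {1..n} {1..n}"
    by (rule bij_betw_cong[THEN iffD1, rotated]) (simp add: perm_complement_def)
qed (auto simp: perm_complement_def)

lemma perm_Phi_permutes:
  assumes "\<pi> permutes {1..n}"
  shows "perm_Phi n \<pi> permutes {1..n}"
  unfolding perm_Phi_def perm_inverse_def o_apply
  by (intro perm_complement_permutes perm_reverse_permutes permutes_inv assms)

lemma perm_Phi_apply:
  assumes "i \<in> {1..n}"
  shows "perm_Phi n \<pi> i = n + 1 - inv \<pi> (n + 1 - i)"
  using assms
  by (simp add: perm_Phi_def perm_complement_def perm_reverse_def perm_inverse_def)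

end

theory Submission
  imports Defs
begin

text \<open>
  Write \<open>c i = n + 1 - i\<close> for the order-reversing involution of \<open>{1..n}\<close>. On \<open>{1..n}\<close> the map
  \<open>\<Phi> \<pi>\<close> is \<open>c \<circ> \<pi>\<inverse> \<circ> c\<close>, so its inverse is the conjugate \<open>c \<circ> \<pi> \<circ> c\<close>. At an index \<open>k\<close> the two
  inequalities that define a double deficiency of \<open>\<Phi> \<pi>\<close> compare \<open>k\<close> with \<open>c (\<pi>\<inverse> (c k))\<close> and
  \<open>c (\<pi> (c k))\<close>. Applying \<open>c\<close> reverses both of them: the condition on \<open>\<Phi> \<pi>\<close> at \<open>k\<close> becomes the
  condition on \<open>\<pi>\<inverse>\<close> at \<open>c k\<close>, and the condition on its inverse becomes the one on \<open>\<pi>\<close>.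
  Inversion exchanges the two conditions and order reversal flips them, so together they
  preserve the notion of a double deficiency, only moving the index from \<open>k\<close> to \<open>c k\<close>
  (\<open>double_deficiency_perm_Phi_iff\<close>). Equality of the cardinalities follows since \<open>c\<close> is injective on \<open>{1..n}\<close>.
\<close>

lemma inv_perm_Phi_apply:
  assumes "\<pi> permutes {1..n}" and "i \<in> {1..n}"
  shows "inv (perm_Phi n \<pi>) i = n + 1 - \<pi> (n + 1 - i)"
proof (rule permutes_inv_eq[OF perm_Phi_permutes[OF assms(1)], THEN iffD2])
  have "n + 1 - i \<in> {1..n}"
    using assms(2) by auto
  then have "\<pi> (n + 1 - i) \<in> {1..n}"
    by (simp only: permutes_in_image[OF assms(1)])
  then show "perm_Phi n \<pi> (n + 1 - \<pi> (n + 1 - i)) = i"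
    using assms(2) by (subst perm_Phi_apply) (auto simp: permutes_inverses[OF assms(1)])
qed

text \<open>
  Complementing an index reverses the order, which turns the deficiency of \<open>perm_Phi n \<pi>\<close> at \<open>k\<close>
  into the condition on \<open>inv \<pi>\<close> at \<open>n + 1 - k\<close>, and the condition on its inverse into the
  deficiency of \<open>\<pi>\<close> there.
\<close>

lemma double_deficiency_perm_Phi_iff:
  assumes "\<pi> permutes {1..n}" and "k \<in> {1..n}"
  shows "k \<in> double_deficiencies n (perm_Phi n \<pi>) \<longleftrightarrow> n + 1 - k \<in> double_deficiencies n \<pi>"
proof -
  have c: "n + 1 - k \<in> {1..n}"
    using assms(2) by auto
  have "inv \<pi> (n + 1 - k) \<in> {1..n}"
    using c by (simp only: permutes_in_image[OF permutes_inv[OF assms(1)]])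
  then have "n + 1 - inv \<pi> (n + 1 - k) < k \<longleftrightarrow> n + 1 - k < inv \<pi> (n + 1 - k)"
    using assms(2) unfolding atLeastAtMost_iff by linarith
  moreover have "k < n + 1 - \<pi> (n + 1 - k) \<longleftrightarrow> \<pi> (n + 1 - k) < n + 1 - k"
    by linarith
  ultimately show ?thesis
    using assms(2) c
    unfolding double_deficiencies_def mem_Collect_eq
      perm_Phi_apply[OF assms(2)] inv_perm_Phi_apply[OF assms]
    by blast
qed

theorem proposition10:
  fixes n :: nat and \<pi> :: "nat \<Rightarrow> nat"
  assumes "\<pi> permutes {1..n}"
  shows "DD n (perm_Phi n \<pi>) = DD n \<pi> \<and>
    double_deficiencies n (perm_Phi n \<pi>) = {n + 1 - k | k. k \<in> double_deficiencies n \<pi>}"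
proof -
  have range: "double_deficiencies n \<sigma> \<subseteq> {1..n}" for \<sigma>
    by (auto simp: double_deficiencies_def)
  have image: "double_deficiencies n (perm_Phi n \<pi>) = (\<lambda>k. n + 1 - k) ` double_deficiencies n \<pi>"
  proof (intro equalityI subsetI)
    fix k assume k: "k \<in> double_deficiencies n (perm_Phi n \<pi>)"
    with range have k_range: "k \<in> {1..n}" by blast
    have "n + 1 - k \<in> double_deficiencies n \<pi>"
      using double_deficiency_perm_Phi_iff[OF assms k_range] k by blast
    moreover have "k = n + 1 - (n + 1 - k)"
      using k_range by auto
    ultimately show "k \<in> (\<lambda>k. n + 1 - k) ` double_deficiencies n \<pi>"
      by (rule rev_image_eqI)
  next
    fix k assume "k \<in> (\<lambda>k. n + 1 - k) ` double_deficiencies n \<pi>"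
    then obtain j where j: "j \<in> double_deficiencies n \<pi>" "k = n + 1 - j" by blast
    with range have "j \<in> {1..n}" by blast
    with j have "k \<in> {1..n}" "n + 1 - k = j" by auto
    with j(1) show "k \<in> double_deficiencies n (perm_Phi n \<pi>)"
      by (simp only: double_deficiency_perm_Phi_iff[OF assms])
  qed
  have "inj_on (\<lambda>k. n + 1 - k) {1..n}"
    by (rule inj_onI) auto
  then have "inj_on (\<lambda>k. n + 1 - k) (double_deficiencies n \<pi>)"
    using range by (rule inj_on_subset)
  then have "DD n (perm_Phi n \<pi>) = DD n \<pi>"
    unfolding DD_def image by (rule card_image)
  with image show ?thesis
    by blast
qed

end
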